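(* Let $c \in \mathbb{C}$ and $r > 0$ satisfy $r \le |c|$, and let $$D = \{ z \in \mathbb{C} \mid |z-c| \le r \}.$$ Let $Z$ be a $\mathbb{C}\setminus\{0\}$-valued random variable on a probability space which has a complex harmonic mean $\mathbf{H}[Z]$. If $\operatorname{Range}[Z] \subset D$, then $\mathbf{H}[Z] \in D$.
   Context: For a complex-valued random variable $Z$, $\operatorname{Range}[Z]$ denotes the support of the distribution of $Z$. For a $\mathbb{C}\setminus\{0\}$-valued random variable $Z$, the complex harmonic mean is $\mathbf{H}[Z] := \mathbf{E}[Z^{-1}]^{-1}$, defined whenever the expectation $\mathbf{E}[Z^{-1}]$ exists ($Z^{-1}$ is integrable) and is a non-zero complex number. *)

theory Defs
  imports "HOL-Probability.Probability"
begin

definition measure_support :: "'a::topological_space measure \<Rightarrow> 'a set" where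
  "measure_support N = {x. \<forall>U. open U \<and> x \<in> U \<longrightarrow> emeasure N U > 0}"

text \<open>The distribution is taken on all of the complex plane, so the range is closed there
  and may contain 0 even if the random variable never takes the value 0.\<close>

definition rv_range :: "'w measure \<Rightarrow> ('w \<Rightarrow> complex) \<Rightarrow> complex set" where
  "rv_range M Z = measure_support (distr M borel Z)"

definition has_harmonic_mean :: "'w measure \<Rightarrow> ('w \<Rightarrow> complex) \<Rightarrow> bool" where
  "has_harmonic_mean M Z \<longleftrightarrow>
     integrable M (\<lambda>\<omega>. inverse (Z \<omega>)) \<and> (LINT \<omega>|M. inverse (Z \<omega>)) \<noteq> 0"

text \<open>Meaningful only under \<^const>\<open>has_harmonic_mean\<close> and for random variables
  without zeros, since \<^term>\<open>inverse 0 = 0\<close> and non-integrable functions have integral 0.\<close>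

definition harmonic_mean :: "'w measure \<Rightarrow> ('w \<Rightarrow> complex) \<Rightarrow> complex" where
  "harmonic_mean M Z = inverse (LINT \<omega>|M. inverse (Z \<omega>))"

end

theory Submission
  imports Defs
begin

text \<open>Inversion turns the condition \<open>\<bar>z - c\<bar> \<le> r\<close> on \<open>w = 1 / z\<close> into
  \<open>1 - 2 Re (c w) + (\<bar>c\<bar>\<^sup>2 - r\<^sup>2) \<bar>w\<bar>\<^sup>2 \<le> 0\<close>, which is convex in \<open>w\<close>
  because \<open>r \<le> \<bar>c\<bar>\<close>, and so is preserved by taking expectations.\<close>

text \<open>Every point outside the support has a null open neighbourhood, and this can be shrunk to
  a null member of a countable basis. So countably many null sets cover the complement of the
  support.\<close>

lemma AE_in_measure_support:
  fixes N :: "'a::second_countable_topology measure"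
  assumes sets: "sets N = sets borel"
  shows "AE x in N. x \<in> measure_support N"
proof -
  obtain B :: "'a set set" where B: "countable B" "topological_basis B"
    using ex_countable_basis by blast
  have "(\<Union>U\<in>{U\<in>B. emeasure N U = 0}. U) \<in> null_sets N"
  proof (rule null_sets_UN')
    show "countable {U\<in>B. emeasure N U = 0}"
      using B(1) by simp
    show "U \<in> null_sets N" if "U \<in> {U\<in>B. emeasure N U = 0}" for U
      using that topological_basis_open[OF B(2)] sets by (auto intro!: null_setsI)
  qed
  then show ?thesis
  proof (rule AE_I'[rotated 1, rotated 1], safe)
    fix x assume "x \<notin> measure_support N"
    then obtain U where U: "open U" "x \<in> U" "emeasure N U = 0"
      by (auto simp: measure_support_def)
    obtain V where V: "V \<in> B" "x \<in> V" "V \<subseteq> U"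
      using topological_basisE[OF B(2) U(1,2)] by blast
    have "emeasure N V \<le> emeasure N U"
      using U(1) V(3) sets by (intro emeasure_mono) auto
    then show "x \<in> (\<Union>U\<in>{U\<in>B. emeasure N U = 0}. U)"
      using U(3) V by auto
  qed
qed

text \<open>Multiply by \<open>norm w\<close> and square. Being an equivalence, it serves twice:
  forwards at the values of \<open>W\<close>, backwards at their mean.\<close>

lemma norm_inverse_diff_le_iff:
  fixes c w :: complex
  assumes "w \<noteq> 0" and "r \<ge> 0"
  shows "norm (inverse w - c) \<le> r \<longleftrightarrow>
    1 - 2 * Re (c * w) + ((norm c)\<^sup>2 - r\<^sup>2) * (norm w)\<^sup>2 \<le> 0"
proof -
  have "inverse w - c = (1 - c * w) / w"
    using assms by (simp add: field_simps)
  then have "norm (inverse w - c) \<le> r \<longleftrightarrow> norm (1 - c * w) \<le> r * norm w"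
    using assms by (simp add: norm_divide pos_divide_le_eq)
  also have "\<dots> \<longleftrightarrow> (norm (1 - c * w))\<^sup>2 \<le> (r * norm w)\<^sup>2"
    using assms by (intro abs_le_square_iff[THEN trans[rotated]]) simp
  also have "(norm (1 - c * w))\<^sup>2 = 1 - 2 * Re (c * w) + (norm (c * w))\<^sup>2"
    unfolding cmod_power2 by (simp add: power2_eq_square algebra_simps)
  finally show ?thesis
    by (simp add: norm_mult power_mult_distrib algebra_simps)
qed

text \<open>The two sides differ by \<open>(norm (w - m))\<^sup>2\<close>. The lower bound is affine
  in \<open>w\<close>, and exact at \<open>w = m\<close>.\<close>

lemma norm_square_ge_tangent:
  fixes m w :: complex
  shows "(norm w)\<^sup>2 \<ge> 2 * Re (cnj m * w) - (norm m)\<^sup>2"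
proof -
  have "(norm w)\<^sup>2 - 2 * Re (cnj m * w) + (norm m)\<^sup>2 = (norm (w - m))\<^sup>2"
    unfolding cmod_power2 by (simp add: power2_eq_square algebra_simps)
  then show ?thesis
    using zero_le_power2[of "norm (w - m)"] by linarith
qed

theorem theorem5p1:
  fixes M :: "'w measure" and Z :: "'w \<Rightarrow> complex" and c :: complex and r :: real
  assumes "r > 0" and "r \<le> norm c"
    and "prob_space M"
    and "Z \<in> borel_measurable M"
    and "\<And>\<omega>. \<omega> \<in> space M \<Longrightarrow> Z \<omega> \<noteq> 0"
    and "has_harmonic_mean M Z"
    and "rv_range M Z \<subseteq> {z. norm (z - c) \<le> r}"
  shows "harmonic_mean M Z \<in> {z. norm (z - c) \<le> r}"
proof -
  interpret prob_space M by fact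
  define W where "W = (\<lambda>\<omega>. inverse (Z \<omega>))"
  define m where "m = (LINT \<omega>|M. W \<omega>)"
  define k where "k = (norm c)\<^sup>2 - r\<^sup>2"
  have int: "integrable M W" and "m \<noteq> 0"
    using assms(6) by (auto simp: has_harmonic_mean_def W_def m_def)
  have "k \<ge> 0"
    using assms(1,2) by (simp add: k_def power_mono)
  have "AE z in distr M borel Z. norm (z - c) \<le> r"
    using AE_in_measure_support[of "distr M borel Z"] assms(7)
    by (auto simp: rv_range_def)
  then have "AE \<omega> in M. norm (Z \<omega> - c) \<le> r"
    using assms(4) by (subst (asm) AE_distr_iff) auto
  \<comment> \<open>\<open>\<bar>W\<bar>\<^sup>2\<close> need not be integrable, so it is replaced by its tangent at the mean.\<close>
  then have "AE \<omega> in M. 1 - 2 * Re (c * W \<omega>) + k * (2 * Re (cnj m * W \<omega>) - (norm m)\<^sup>2) \<le> 0"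
    using AE_space
  proof eventually_elim
    case (elim \<omega>)
    \<comment> \<open>\<open>AE_space\<close> supplies \<open>\<omega> \<in> space M\<close>, where
      \<open>Z\<close> is nonzero and hence \<open>W \<omega> \<noteq> 0\<close>.\<close>
    then have "1 - 2 * Re (c * W \<omega>) + k * (norm (W \<omega>))\<^sup>2 \<le> 0"
      using norm_inverse_diff_le_iff[of "W \<omega>" r c] assms(1,5) by (simp add: W_def k_def)
    then show ?case
      using mult_left_mono[OF norm_square_ge_tangent[of m "W \<omega>"] \<open>k \<ge> 0\<close>] by linarith
  qed
  then have "0 \<le> (LINT \<omega>|M. - (1 - 2 * Re (c * W \<omega>) + k * (2 * Re (cnj m * W \<omega>) - (norm m)\<^sup>2)))"
    by (intro integral_nonneg_AE) (auto elim: eventually_mono)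
  then have "(LINT \<omega>|M. 1 - 2 * Re (c * W \<omega>) + k * (2 * Re (cnj m * W \<omega>) - (norm m)\<^sup>2)) \<le> 0"
    by (simp only: integral_minus neg_0_le_iff_le)
  \<comment> \<open>The integrand is affine in \<open>W\<close> and \<open>M\<close> has total mass
    1, so integrating amounts to replacing \<open>W \<omega>\<close> by \<open>m\<close>.\<close>
  moreover have "(LINT \<omega>|M. 1 - 2 * Re (c * W \<omega>) + k * (2 * Re (cnj m * W \<omega>) - (norm m)\<^sup>2))
      = 1 - 2 * Re (c * m) + k * (2 * Re (cnj m * m) - (norm m)\<^sup>2)"
  proof -
    have lin: "integrable M (\<lambda>\<omega>. Re (a * W \<omega>))" "(LINT \<omega>|M. Re (a * W \<omega>)) = Re (a * m)" for a
      using int by (auto simp: m_def integral_Re simp del: times_complex.sel)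
    show ?thesis
      using lin by (simp add: prob_space del: times_complex.sel)
  qed
  \<comment> \<open>The tangent touches at \<open>m\<close>, so the quadratic inequality is
    recovered there without loss.\<close>
  moreover have "Re (cnj m * m) = (norm m)\<^sup>2"
    unfolding cmod_power2 by (simp add: power2_eq_square)
  ultimately have "1 - 2 * Re (c * m) + k * (norm m)\<^sup>2 \<le> 0"
    by (simp del: times_complex.sel)
  then show ?thesis
    using norm_inverse_diff_le_iff[OF \<open>m \<noteq> 0\<close>, of r c] assms(1)
    by (simp add: harmonic_mean_def m_def W_def k_def)
qed

end
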